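(* Let $(\mathbf E,\|\cdot\|)$ be a normed space and let $F:\mathbf E\to\mathbb R$ be $L_1$-smooth w.r.t. $\|\cdot\|$. Let $x^1,\dots,x^T\in\mathbf E$ be deterministic vectors, $(\lambda_1,\dots,\lambda_T)\in\Delta_T$, and let $a^1,\dots,a^T$ be random vectors in $\mathbf E$ such that $\mathbb E[a^t\mid a^{t-1},\dots,a^1]=x^t$ for all $t\in[T]$. Let $\bar x^T=\sum_{t=1}^T\lambda_tx^t$ and $\bar a^T=\sum_{t=1}^T\lambda_ta^t$. Then $$\big|\mathbb E[F(\bar a^T)-F(\bar x^T)]\big|\le\frac{L_1}{2}\sum_{t=1}^T\lambda_t^2\,\mathbb E\big[\|a^t-x^t\|^2\big].$$
   Context: $\Delta_T=\{\lambda\in\mathbb R^T:\lambda_t\ge0,\ \sum_t\lambda_t=1\}$. A differentiable function $F$ is $L_1$-smooth w.r.t. $\|\cdot\|$ if $\|\nabla F(u)-\nabla F(u')\|_*\le L_1\|u-u'\|$ for all $u,u'$, where $\|\cdot\|_*$ is the dual norm. *)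

theory Defs
  imports "HOL-Probability.Probability"
begin

definition prob_simplex :: "nat \<Rightarrow> (nat \<Rightarrow> real) set" where
  "prob_simplex T = {l. (\<forall>t\<in>{1..T}. 0 \<le> l t) \<and> (\<Sum>t=1..T. l t) = 1}"

text \<open>The gradient of a function at a point is an element of the dual space, represented here
  by the type of bounded linear functionals; the norm of that type is the operator norm, that is,
  the dual norm.\<close>

definition L_smooth :: "real \<Rightarrow> ('e::real_normed_vector \<Rightarrow> real) \<Rightarrow> bool" where
  "L_smooth L F \<longleftrightarrow>
     (\<exists>F' :: 'e \<Rightarrow> 'e \<Rightarrow>\<^sub>L real.
        (\<forall>u. (F has_derivative blinfun_apply (F' u)) (at u)) \<and>
        (\<forall>u u'. norm (F' u - F' u') \<le> L * norm (u - u')))"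

text \<open>The library restricts Bochner integration to second countable spaces. In an
  arbitrary normed space a random vector has to be strongly measurable, that is, Borel measurable
  with separable range: otherwise sums of random vectors need not be measurable. The lemmas
  below show that nothing changes in the second countable case.\<close>

definition random_vector :: "'w measure \<Rightarrow> ('w \<Rightarrow> 'e::real_normed_vector) \<Rightarrow> bool" where
  "random_vector M f \<longleftrightarrow>
     f \<in> borel_measurable M \<and> (\<exists>D. countable D \<and> f ` space M \<subseteq> closure D)"

definition has_strong_integral ::
    "'w measure \<Rightarrow> ('w \<Rightarrow> 'e::real_normed_vector) \<Rightarrow> 'e \<Rightarrow> bool" where
  "has_strong_integral M f I \<longleftrightarrow>
     random_vector M f \<and>
     (\<exists>s. (\<forall>i. Bochner_Integration.simple_bochner_integrable M (s i)) \<and>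
          (\<lambda>i. \<integral>\<^sup>+\<omega>. ennreal (norm (f \<omega> - s i \<omega>)) \<partial>M) \<longlonglongrightarrow> 0 \<and>
          (\<lambda>i. Bochner_Integration.simple_bochner_integral M (s i)) \<longlonglongrightarrow> I)"

lemma random_vector_second_countable:
  fixes f :: "'w \<Rightarrow> 'e::{real_normed_vector, second_countable_topology}"
  shows "random_vector M f \<longleftrightarrow> f \<in> borel_measurable M"
proof -
  obtain D :: "'e set" where D: "countable D" "\<And>X. open X \<Longrightarrow> X \<noteq> {} \<Longrightarrow> \<exists>d\<in>D. d \<in> X"
    using countable_dense_setE by blast
  have "x \<in> closure D" for x
    unfolding closure_iff_nhds_not_empty using D(2)
    by (metis disjoint_iff empty_iff subsetD)
  with D(1) show ?thesis
    unfolding random_vector_def by blast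
qed

lemma has_strong_integral_second_countable:
  fixes f :: "'w \<Rightarrow> 'e::{real_normed_vector, second_countable_topology}"
  shows "has_strong_integral M f I \<longleftrightarrow> has_bochner_integral M f I"
  unfolding has_strong_integral_def has_bochner_integral.simps random_vector_second_countable
  by auto

text \<open>\<open>g\<close> is a version of the conditional expectation of \<open>f\<close> given the sub-sigma-algebra \<open>G\<close>.
  Taking \<open>A = space M\<close> shows that \<open>f\<close> is integrable.\<close>

definition is_cond_exp ::
    "'w measure \<Rightarrow> 'w measure \<Rightarrow> ('w \<Rightarrow> 'e::real_normed_vector) \<Rightarrow> ('w \<Rightarrow> 'e) \<Rightarrow> bool" where
  "is_cond_exp M G f g \<longleftrightarrow>
     subalgebra M G \<and> random_vector G g \<and>
     (\<forall>A\<in>sets G. \<exists>I. has_strong_integral M (\<lambda>\<omega>. indicator A \<omega> *\<^sub>R f \<omega>) I \<and>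
                     has_strong_integral M (\<lambda>\<omega>. indicator A \<omega> *\<^sub>R g \<omega>) I)"

text \<open>The sigma-algebra generated by \<open>a 1, \<dots>, a (t - 1)\<close>; it is trivial for \<open>t = 1\<close>.\<close>

definition past ::
    "'w measure \<Rightarrow> (nat \<Rightarrow> 'w \<Rightarrow> 'e::real_normed_vector) \<Rightarrow> nat \<Rightarrow> 'w measure" where
  "past M a t = sigma (space M) {a s -` B \<inter> space M | s B. s \<in> {1..<t} \<and> B \<in> sets borel}"

lemma subalgebra_past:
  assumes "\<And>s. s \<in> {1..<t} \<Longrightarrow> random_vector M (a s)"
  shows "subalgebra M (past M a t)"
proof -
  have "{a s -` B \<inter> space M | s B. s \<in> {1..<t} \<and> B \<in> sets borel} \<subseteq> sets M"
    using assms unfolding random_vector_def by (auto intro: measurable_sets)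
  moreover from this have "sigma_sets (space M)
      {a s -` B \<inter> space M | s B. s \<in> {1..<t} \<and> B \<in> sets borel} \<subseteq> sets M"
    by (rule sets.sigma_sets_subset)
  ultimately show ?thesis
    unfolding subalgebra_def past_def
    by (metis (no_types, lifting) sets.space_closed order_trans sets_measure_of space_measure_of)
qed

end

theory Submission
  imports Defs
begin

text \<open>Replace the \<open>x t\<close> by the \<open>a t\<close> one at a time. Each step changes the argument of \<open>F\<close> from
  \<open>y (t - 1)\<close> to \<open>y t = y (t - 1) + d t\<close> with \<open>d t = l t *\<^sub>R (a t - x t)\<close>, and by \<open>L\<^sub>1\<close>-smoothness it
  changes \<open>F\<close> by \<open>F' (y (t - 1)) (d t)\<close> up to an error of at most \<open>L\<^sub>1 / 2 * (norm (d t))\<^sup>2\<close>. The linear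
  term has expectation zero: \<open>F' (y (t - 1))\<close> is a random functional depending only on the past, to
  which \<open>d t\<close> is orthogonal. As the dual space need not be separable, strong measurability of this
  functional comes from continuity of \<open>F'\<close> and the separable range of \<open>y (t - 1)\<close>.\<close>

section \<open>Closure properties of strongly measurable random vectors\<close>

lemma random_vector_compose:
  fixes h :: "'a::real_normed_vector \<Rightarrow> 'b::real_normed_vector"
  assumes "random_vector M f" "continuous_on UNIV h"
  shows "random_vector M (\<lambda>\<omega>. h (f \<omega>))"
proof -
  obtain D where D: "countable D" "f ` space M \<subseteq> closure D"
    using assms(1) unfolding random_vector_def by blast
  have "h ` closure D \<subseteq> closure (h ` D)"
    using image_closure_subset[of D h "closure (h ` D)"] assms(2)
    by (meson closed_closure closure_subset continuous_on_subset subset_UNIV)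
  then have "(\<lambda>\<omega>. h (f \<omega>)) ` space M \<subseteq> closure (h ` D)"
    using D(2) by auto
  moreover have "(\<lambda>\<omega>. h (f \<omega>)) \<in> borel_measurable M"
    using assms borel_measurable_continuous_onI measurable_compose
    unfolding random_vector_def by blast
  ultimately show ?thesis
    using D(1) unfolding random_vector_def by blast
qed

text \<open>A countable set whose closure contains the range gives a cover of the range by countably
  many balls of radius \<open>e\<close>; sending a point to the first ball that contains it is a
  measurable choice. The approximant is written \<open>d (n \<omega>)\<close> so that all
  measurability sits in the integer-valued index \<open>n\<close>.\<close>

lemma random_vector_approx:
  fixes f :: "'w \<Rightarrow> 'e::real_normed_vector"
  assumes "random_vector M f" "e > 0"
  shows "\<exists>(d :: nat \<Rightarrow> 'e) n. n \<in> measurable M (count_space UNIV) \<and>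
           (\<forall>\<omega>\<in>space M. dist (f \<omega>) (d (n \<omega>)) < e)"
proof -
  obtain D where D: "countable D" "f ` space M \<subseteq> closure D" and f[measurable]: "f \<in> borel_measurable M"
    using assms(1) unfolding random_vector_def by blast
  define d where "d = from_nat_into (insert 0 D)"
  define n where "n = (\<lambda>\<omega>. LEAST i. f \<omega> \<in> ball (d i) e)"
  have ex: "\<exists>i. f \<omega> \<in> ball (d i) e" if "\<omega> \<in> space M" for \<omega>
  proof -
    have "f \<omega> \<in> closure D" using D(2) that by blast
    then obtain y where "y \<in> D" "dist y (f \<omega>) < e"
      using assms(2) unfolding closure_approachable by blast
    moreover from this D(1) obtain i where "d i = y"
      unfolding d_def by (metis countable_insert from_nat_into_surj insertCI)
    ultimately show ?thesis by auto
  qed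
  have "n \<in> measurable M (count_space UNIV)"
    unfolding n_def
  proof (rule measurable_Least)
    show "Measurable.pred M (\<lambda>\<omega>. f \<omega> \<in> ball (d i) e)" for i
      by (rule pred_sets2[OF _ f]) simp
  qed
  moreover have "dist (f \<omega>) (d (n \<omega>)) < e" if "\<omega> \<in> space M" for \<omega>
    using LeastI_ex[OF ex[OF that]] unfolding n_def by (simp add: dist_commute)
  ultimately show ?thesis by blast
qed

text \<open>Converse of the preceding lemma. Taking \<open>e = 1 / (k + 1)\<close> makes
  \<open>f\<close> a pointwise limit of countably valued measurable maps, and the values of all of
  them together form a countable set whose closure contains the range of \<open>f\<close>.\<close>

lemma random_vectorI_approx:
  fixes f :: "'w \<Rightarrow> 'e::real_normed_vector"
  assumes "\<And>e. e > 0 \<Longrightarrow> \<exists>(d :: nat \<Rightarrow> 'e) n. n \<in> measurable M (count_space UNIV) \<and>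
             (\<forall>\<omega>\<in>space M. dist (f \<omega>) (d (n \<omega>)) < e)"
  shows "random_vector M f"
proof -
  have "\<forall>k. \<exists>(d :: nat \<Rightarrow> 'e) n. n \<in> measurable M (count_space UNIV) \<and>
             (\<forall>\<omega>\<in>space M. dist (f \<omega>) (d (n \<omega>)) < inverse (real (Suc k)))"
    using assms by simp
  then obtain d :: "nat \<Rightarrow> nat \<Rightarrow> 'e" and n
    where n[measurable]: "\<And>k. n k \<in> measurable M (count_space UNIV)"
      and d: "\<And>k \<omega>. \<omega> \<in> space M \<Longrightarrow> dist (f \<omega>) (d k (n k \<omega>)) < inverse (real (Suc k))"
    by metis
  have lim: "(\<lambda>k. d k (n k \<omega>)) \<longlonglongrightarrow> f \<omega>" if "\<omega> \<in> space M" for \<omega>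
  proof (rule metric_tendsto_imp_tendsto[OF LIMSEQ_inverse_real_of_nat])
    show "\<forall>\<^sub>F k in sequentially. dist (d k (n k \<omega>)) (f \<omega>) \<le> dist (inverse (real (Suc k))) 0"
      using d[OF that] by (auto intro!: always_eventually less_imp_le simp: dist_commute)
  qed
  have "f \<in> borel_measurable M"
    by (rule borel_measurable_LIMSEQ_metric[OF _ lim]) (auto intro: measurable_compose[OF n])
  moreover have "countable (\<Union>k. range (d k))" by simp
  moreover have "f ` space M \<subseteq> closure (\<Union>k. range (d k))"
  proof safe
    fix \<omega> assume "\<omega> \<in> space M"
    from lim[OF this] show "f \<omega> \<in> closure (\<Union>k. range (d k))"
      unfolding closure_sequential by (intro exI[of _ "\<lambda>k. d k (n k \<omega>)"]) auto
  qed
  ultimately show ?thesis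
    unfolding random_vector_def by blast
qed

text \<open>Without second countability the Borel sets of a product may exceed the product
  sigma-algebra, so measurability of the components alone does not suffice. Countably valued
  approximations of the components combine into one of the pair.\<close>

lemma random_vector_Pair:
  fixes f :: "'w \<Rightarrow> 'a::real_normed_vector" and g :: "'w \<Rightarrow> 'b::real_normed_vector"
  assumes "random_vector M f" "random_vector M g"
  shows "random_vector M (\<lambda>\<omega>. (f \<omega>, g \<omega>))"
proof (rule random_vectorI_approx)
  fix e :: real assume "e > 0"
  then have e: "e / 2 > 0" by simp
  obtain d :: "nat \<Rightarrow> 'a" and n :: "'w \<Rightarrow> nat" where [measurable]: "n \<in> measurable M (count_space UNIV)"
    and d: "\<And>\<omega>. \<omega> \<in> space M \<Longrightarrow> dist (f \<omega>) (d (n \<omega>)) < e / 2"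
    using random_vector_approx[OF assms(1) e] by blast
  obtain d' :: "nat \<Rightarrow> 'b" and n' :: "'w \<Rightarrow> nat" where [measurable]: "n' \<in> measurable M (count_space UNIV)"
    and d': "\<And>\<omega>. \<omega> \<in> space M \<Longrightarrow> dist (g \<omega>) (d' (n' \<omega>)) < e / 2"
    using random_vector_approx[OF assms(2) e] by blast
  \<comment> \<open>The two indices are packed into one natural number.\<close>
  let ?n = "\<lambda>\<omega>. prod_encode (n \<omega>, n' \<omega>)"
  let ?d = "\<lambda>i. (d (fst (prod_decode i)), d' (snd (prod_decode i)))"
  have "?n \<in> measurable M (count_space UNIV)" by measurable
  moreover have "dist (f \<omega>, g \<omega>) (?d (?n \<omega>)) < e" if "\<omega> \<in> space M" for \<omega>
    using d[OF that] d'[OF that] norm_Pair_le[of "f \<omega> - d (n \<omega>)" "g \<omega> - d' (n' \<omega>)"]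
    by (simp add: dist_norm)
  ultimately show "\<exists>(d :: nat \<Rightarrow> 'a \<times> 'b) n. n \<in> measurable M (count_space UNIV) \<and>
      (\<forall>\<omega>\<in>space M. dist (f \<omega>, g \<omega>) (d (n \<omega>)) < e)"
    by (intro exI[of _ ?d] exI[of _ ?n]) simp
qed

lemma random_vector_const: "random_vector M (\<lambda>_. c)"
  unfolding random_vector_def by (auto intro!: exI[of _ "{c}"])

lemma random_vector_scaleR:
  "random_vector M f \<Longrightarrow> random_vector M (\<lambda>\<omega>. c *\<^sub>R f \<omega>)"
  by (rule random_vector_compose) (auto intro!: continuous_intros)

lemma random_vector_add:
  assumes "random_vector M f" "random_vector M g"
  shows "random_vector M (\<lambda>\<omega>. f \<omega> + g \<omega>)"
  using random_vector_compose[OF random_vector_Pair[OF assms], of "\<lambda>p. fst p + snd p"]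
  by (simp add: continuous_intros)

lemma random_vector_diff:
  assumes "random_vector M f" "random_vector M g"
  shows "random_vector M (\<lambda>\<omega>. f \<omega> - g \<omega>)"
  using random_vector_compose[OF random_vector_Pair[OF assms], of "\<lambda>p. fst p - snd p"]
  by (simp add: continuous_intros)

lemma random_vector_sum:
  "(\<And>i. i \<in> I \<Longrightarrow> random_vector M (f i)) \<Longrightarrow> random_vector M (\<lambda>\<omega>. \<Sum>i\<in>I. f i \<omega>)"
  by (induction I rule: infinite_finite_induct)
     (simp_all add: random_vector_const random_vector_add)

lemma borel_measurable_norm_random_vector:
  "random_vector M f \<Longrightarrow> (\<lambda>\<omega>. norm (f \<omega>)) \<in> borel_measurable M"
  using random_vector_compose[of M f norm]
  by (simp add: random_vector_second_countable continuous_intros)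

lemma borel_measurable_blinfun_apply_random_vector:
  assumes "random_vector M Z" "random_vector M f"
  shows "(\<lambda>\<omega>. blinfun_apply (Z \<omega>) (f \<omega>) :: real) \<in> borel_measurable M"
  using random_vector_compose[OF random_vector_Pair[OF assms], of "\<lambda>p. blinfun_apply (fst p) (snd p)"]
  by (simp add: random_vector_second_countable continuous_intros)

lemma random_vector_subalgebra:
  assumes "subalgebra M G" "random_vector G f"
  shows "random_vector M f"
  using assms measurable_from_subalg unfolding random_vector_def subalgebra_def by metis

lemma random_vector_past:
  assumes "random_vector M (a s)" "s \<in> {1..<t}"
  shows "random_vector (past M a t) (a s)"
proof -
  have "a s -` B \<inter> space M \<in> sets (past M a t)" if "B \<in> sets borel" for B
    unfolding past_def using assms(2) that by (subst sets_measure_of) auto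
  moreover have "space (past M a t) = space M"
    unfolding past_def by (rule space_measure_of) auto
  ultimately show ?thesis
    using assms(1) unfolding random_vector_def by (auto intro!: measurableI)
qed

section \<open>Strong integrals: norms and bounded functionals\<close>

lemma simple_bochner_integrable_random_vector:
  assumes "Bochner_Integration.simple_bochner_integrable M s"
  shows "random_vector M s"
proof -
  have s: "simple_function M s"
    using assms by (rule Bochner_Integration.simple_bochner_integrable.cases)
  show ?thesis
    unfolding random_vector_def
    using s borel_measurable_simple_function[OF s]
    by (auto intro!: exI[of _ "s ` space M"] countable_finite simple_functionD(1)
        intro: closure_subset[THEN subsetD])
qed

text \<open>A single simple function at finite \<open>L1\<close> distance from \<open>f\<close> is
  enough: the triangle inequality bounds the integral of \<open>norm (f \<omega>)\<close> by that
  distance plus the integral of its norm.\<close>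

lemma has_strong_integral_integrable_norm:
  assumes "has_strong_integral M f I"
  shows "integrable M (\<lambda>\<omega>. norm (f \<omega>))"
proof -
  from assms obtain s where f: "random_vector M f"
    and s: "\<And>i. Bochner_Integration.simple_bochner_integrable M (s i)"
    and lim: "(\<lambda>i. \<integral>\<^sup>+\<omega>. ennreal (norm (f \<omega> - s i \<omega>)) \<partial>M) \<longlonglongrightarrow> 0"
    unfolding has_strong_integral_def by blast
  have "\<forall>\<^sub>F i in sequentially. (\<integral>\<^sup>+\<omega>. ennreal (norm (f \<omega> - s i \<omega>)) \<partial>M) < 1"
    using lim by (rule order_tendstoD) simp
  then obtain i where i: "(\<integral>\<^sup>+\<omega>. ennreal (norm (f \<omega> - s i \<omega>)) \<partial>M) < 1"
    using eventually_happens'[OF sequentially_bot] by blast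
  have si: "random_vector M (s i)"
    by (rule simple_bochner_integrable_random_vector[OF s])
  note [measurable] = borel_measurable_norm_random_vector[OF f]
    borel_measurable_norm_random_vector[OF si]
    borel_measurable_norm_random_vector[OF random_vector_diff[OF f si]]
  have "Bochner_Integration.simple_bochner_integrable M (\<lambda>\<omega>. norm (s i \<omega>))"
    using simple_bochner_integrable_compose2[of "\<lambda>x y. norm x", OF _ s s] by simp
  then have "(\<integral>\<^sup>+\<omega>. ennreal (norm (norm (s i \<omega>))) \<partial>M) < \<infinity>"
    using has_bochner_integral_simple_bochner_integrable has_bochner_integral_implies_finite_norm
    by blast
  then have si_fin: "(\<integral>\<^sup>+\<omega>. ennreal (norm (s i \<omega>)) \<partial>M) < \<infinity>"
    by simp
  have "(\<integral>\<^sup>+\<omega>. ennreal (norm (f \<omega>)) \<partial>M)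
      \<le> (\<integral>\<^sup>+\<omega>. ennreal (norm (f \<omega> - s i \<omega>)) + ennreal (norm (s i \<omega>)) \<partial>M)"
    using norm_triangle_ineq[of "f \<omega> - s i \<omega>" "s i \<omega>" for \<omega>]
    by (intro nn_integral_mono) (simp flip: ennreal_plus)
  also have "\<dots> = (\<integral>\<^sup>+\<omega>. ennreal (norm (f \<omega> - s i \<omega>)) \<partial>M) + (\<integral>\<^sup>+\<omega>. ennreal (norm (s i \<omega>)) \<partial>M)"
    by (rule nn_integral_add) measurable
  also have "\<dots> < \<infinity>"
    using i si_fin by (auto simp: less_top[symmetric])
  finally show ?thesis
    by (intro integrableI_bounded) auto
qed

text \<open>Composing the approximating simple functions with \<open>\<phi>\<close> enlarges their
  \<open>L1\<close> error by at most the factor \<open>norm \<phi>\<close>, and their integrals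
  converge by continuity of \<open>\<phi>\<close>. This moves vector-valued integrals into the
  real-valued Bochner theory.\<close>

lemma has_strong_integral_blinfun_apply:
  fixes \<phi> :: "'e::real_normed_vector \<Rightarrow>\<^sub>L real"
  assumes "has_strong_integral M f I"
  shows "has_bochner_integral M (\<lambda>\<omega>. \<phi> (f \<omega>)) (\<phi> I)"
proof -
  from assms obtain s where f: "random_vector M f"
    and s: "\<And>i. Bochner_Integration.simple_bochner_integrable M (s i)"
    and lim: "(\<lambda>i. \<integral>\<^sup>+\<omega>. ennreal (norm (f \<omega> - s i \<omega>)) \<partial>M) \<longlonglongrightarrow> 0"
    and I: "(\<lambda>i. Bochner_Integration.simple_bochner_integral M (s i)) \<longlonglongrightarrow> I"
    unfolding has_strong_integral_def by blast
  show ?thesis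
  proof (rule has_bochner_integral.intros)
    show "(\<lambda>\<omega>. \<phi> (f \<omega>)) \<in> borel_measurable M"
      by (rule borel_measurable_blinfun_apply_random_vector[OF random_vector_const f])
    show "Bochner_Integration.simple_bochner_integrable M (\<lambda>\<omega>. \<phi> (s i \<omega>))" for i
      using simple_bochner_integrable_compose2[of "\<lambda>x y. \<phi> x", OF _ s s] by simp
    show "(\<lambda>i. Bochner_Integration.simple_bochner_integral M (\<lambda>\<omega>. \<phi> (s i \<omega>))) \<longlonglongrightarrow> \<phi> I"
      using I by (subst simple_bochner_integral_linear[OF _ s])
        (auto intro!: tendsto_intros bounded_linear.linear blinfun.bounded_linear_right)
    show "(\<lambda>i. \<integral>\<^sup>+\<omega>. ennreal (norm (\<phi> (f \<omega>) - \<phi> (s i \<omega>))) \<partial>M) \<longlonglongrightarrow> 0"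
    proof (rule tendsto_sandwich[OF _ _ tendsto_const])
      show "(\<lambda>i. ennreal (norm \<phi>) * (\<integral>\<^sup>+\<omega>. ennreal (norm (f \<omega> - s i \<omega>)) \<partial>M)) \<longlonglongrightarrow> 0"
        using ennreal_tendsto_cmult[OF _ lim, of "ennreal (norm \<phi>)"] by simp
      have "(\<integral>\<^sup>+\<omega>. ennreal (norm (\<phi> (f \<omega>) - \<phi> (s i \<omega>))) \<partial>M)
          \<le> ennreal (norm \<phi>) * (\<integral>\<^sup>+\<omega>. ennreal (norm (f \<omega> - s i \<omega>)) \<partial>M)" for i
      proof -
        have "(\<lambda>\<omega>. norm (f \<omega> - s i \<omega>)) \<in> borel_measurable M"
          by (intro borel_measurable_norm_random_vector random_vector_diff f
              simple_bochner_integrable_random_vector s)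
        then show ?thesis
          using norm_blinfun[of \<phi> "f \<omega> - s i \<omega>" for \<omega>]
          by (subst nn_integral_cmult[symmetric])
            (auto intro!: nn_integral_mono simp: blinfun.diff_right simp flip: ennreal_mult)
      qed
      then show "\<forall>\<^sub>F i in sequentially. (\<integral>\<^sup>+\<omega>. ennreal (norm (\<phi> (f \<omega>) - \<phi> (s i \<omega>))) \<partial>M)
          \<le> ennreal (norm \<phi>) * (\<integral>\<^sup>+\<omega>. ennreal (norm (f \<omega> - s i \<omega>)) \<partial>M)"
        by simp
    qed simp
  qed
qed

section \<open>Orthogonality of conditionally centred vectors to random functionals\<close>

lemma is_cond_exp_integrable_norm:
  assumes "is_cond_exp M G f g"
  shows "integrable M (\<lambda>\<omega>. norm (f \<omega>))" and "integrable M (\<lambda>\<omega>. norm (g \<omega>))"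
proof -
  have sp: "space M \<in> sets G"
    using assms unfolding is_cond_exp_def subalgebra_def by (metis sets.top)
  obtain I where I: "has_strong_integral M (\<lambda>\<omega>. indicator (space M) \<omega> *\<^sub>R f \<omega>) I"
    "has_strong_integral M (\<lambda>\<omega>. indicator (space M) \<omega> *\<^sub>R g \<omega>) I"
    using assms sp unfolding is_cond_exp_def by blast
  show "integrable M (\<lambda>\<omega>. norm (f \<omega>))" "integrable M (\<lambda>\<omega>. norm (g \<omega>))"
    using I[THEN has_strong_integral_integrable_norm]
    by (auto cong: Bochner_Integration.integrable_cong)
qed

text \<open>The case of a constant functional cut off to an event of \<open>G\<close>:
  \<open>f\<close> and \<open>g\<close> have the same strong integral \<open>I\<close> over
  \<open>A\<close>, so the two images under \<open>\<phi>\<close> cancel.\<close>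

lemma is_cond_exp_orthogonal_indicator:
  fixes \<phi> :: "'e::real_normed_vector \<Rightarrow>\<^sub>L real"
  assumes "is_cond_exp M G f g" "A \<in> sets G"
  shows "has_bochner_integral M (\<lambda>\<omega>. indicator A \<omega> * \<phi> (f \<omega> - g \<omega>)) 0"
proof -
  obtain I where I: "has_strong_integral M (\<lambda>\<omega>. indicator A \<omega> *\<^sub>R f \<omega>) I"
    "has_strong_integral M (\<lambda>\<omega>. indicator A \<omega> *\<^sub>R g \<omega>) I"
    using assms unfolding is_cond_exp_def by blast
  show ?thesis
    using has_bochner_integral_diff[OF I[THEN has_strong_integral_blinfun_apply[where \<phi> = \<phi>]]]
    by (simp add: blinfun.scaleR_right blinfun.diff_right right_diff_distrib)
qed

text \<open>On each cell of a countable partition in \<open>G\<close> the functional \<open>Z\<close> is within \<open>e\<close> of a constant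
  one, whose contribution vanishes.\<close>

lemma is_cond_exp_orthogonal:
  fixes Z :: "'w \<Rightarrow> 'e::real_normed_vector \<Rightarrow>\<^sub>L real"
  assumes ce: "is_cond_exp M G f g" and f: "random_vector M f" and Z: "random_vector G Z"
    and int: "integrable M (\<lambda>\<omega>. Z \<omega> (f \<omega> - g \<omega>))"
  shows "(\<integral>\<omega>. Z \<omega> (f \<omega> - g \<omega>) \<partial>M) = 0"
proof -
  let ?d = "\<lambda>\<omega>. norm (f \<omega> - g \<omega>)"
  have sub: "subalgebra M G" and g: "random_vector M g"
    using ce random_vector_subalgebra unfolding is_cond_exp_def by blast+
  note [measurable] = borel_measurable_norm_random_vector[OF random_vector_diff[OF f g]]
  have int_d: "integrable M ?d"
    by (rule Bochner_Integration.integrable_bound[OF Bochner_Integration.integrable_add[OF is_cond_exp_integrable_norm[OF ce]]])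
      (auto intro: norm_triangle_ineq4)
  have bound: "\<bar>\<integral>\<omega>. Z \<omega> (f \<omega> - g \<omega>) \<partial>M\<bar> \<le> e * (\<integral>\<omega>. ?d \<omega> \<partial>M)" if e: "e > 0" for e
  proof -
    obtain \<phi> :: "nat \<Rightarrow> 'e \<Rightarrow>\<^sub>L real" and n :: "'w \<Rightarrow> nat" where n: "n \<in> measurable G (count_space UNIV)"
      and \<phi>: "\<And>\<omega>. \<omega> \<in> space G \<Longrightarrow> dist (Z \<omega>) (\<phi> (n \<omega>)) < e"
      using random_vector_approx[OF Z e] by blast
    \<comment> \<open>The cells on which \<open>Z\<close> is approximated by the same functional
      \<open>\<phi> i\<close>. They lie in \<open>G\<close> because \<open>Z\<close> is measurable
      with respect to \<open>G\<close>.\<close>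
    define A where "A = (\<lambda>i. n -` {i} \<inter> space M)"
    have AG: "A i \<in> sets G" for i
      using measurable_sets[OF n, of "{i}"] sub unfolding A_def subalgebra_def by simp
    then have AM[measurable]: "A i \<in> sets M" for i
      using sub unfolding subalgebra_def by blast
    have UN: "(\<Union>i. A i) = space M" and disj: "\<And>i j. i \<noteq> j \<Longrightarrow> A i \<inter> A j = {}"
      unfolding A_def by auto
    have sums: "(\<lambda>i. LINT \<omega>:A i|M. h \<omega>) sums (\<integral>\<omega>. h \<omega> \<partial>M)" if "integrable M h" for h :: "'w \<Rightarrow> real"
    proof -
      have "(\<lambda>k. \<integral>\<omega>. (\<Sum>i<k. indicator (A i) \<omega> * h \<omega>) \<partial>M) \<longlonglongrightarrow> (\<integral>\<omega>. h \<omega> \<partial>M)"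
      proof (rule integral_dominated_convergence[where w = "\<lambda>\<omega>. norm (h \<omega>)"])
        \<comment> \<open>Each point lies in exactly one cell, the one with index
          \<open>n \<omega>\<close>; the partial sum is therefore \<open>h\<close> cut off to
          \<open>n \<omega> < k\<close>, which is dominated by \<open>h\<close> and equals it
          eventually.\<close>
        have *: "(\<Sum>i<k. indicator (A i) \<omega> * h \<omega>) = indicator {..<k} (n \<omega>) * h \<omega>"
          if "\<omega> \<in> space M" for \<omega> k
          using that unfolding A_def
          by (simp add: indicator_def sum.delta' flip: sum_distrib_right)
        show "AE \<omega> in M. (\<lambda>k. \<Sum>i<k. indicator (A i) \<omega> * h \<omega>) \<longlonglongrightarrow> h \<omega>"
        proof (rule AE_I2)
          fix \<omega> assume \<omega>: "\<omega> \<in> space M"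
          have "\<forall>\<^sub>F k in sequentially. (\<Sum>i<k. indicator (A i) \<omega> * h \<omega>) = h \<omega>"
            using eventually_gt_at_top[of "n \<omega>"] by eventually_elim (simp add: *[OF \<omega>])
          then show "(\<lambda>k. \<Sum>i<k. indicator (A i) \<omega> * h \<omega>) \<longlonglongrightarrow> h \<omega>"
            by (rule tendsto_eventually)
        qed
        show "AE \<omega> in M. norm (\<Sum>i<k. indicator (A i) \<omega> * h \<omega>) \<le> norm (h \<omega>)" for k
          by (rule AE_I2, subst *) (auto split: split_indicator)
      qed (use that in auto)
      moreover have "(\<integral>\<omega>. (\<Sum>i<k. indicator (A i) \<omega> * h \<omega>) \<partial>M) = (\<Sum>i<k. LINT \<omega>:A i|M. h \<omega>)" for k
        using integrable_mult_indicator[OF AM that]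
        by (subst Bochner_Integration.integral_sum) (simp_all add: set_lebesgue_integral_def)
      ultimately show ?thesis unfolding sums_def by simp
    qed
    have cell: "\<bar>LINT \<omega>:A i|M. Z \<omega> (f \<omega> - g \<omega>)\<bar> \<le> e * (LINT \<omega>:A i|M. ?d \<omega>)" for i
    proof -
      have 0: "has_bochner_integral M (\<lambda>\<omega>. indicator (A i) \<omega> * \<phi> i (f \<omega> - g \<omega>)) 0"
        by (rule is_cond_exp_orthogonal_indicator[OF ce AG])
      have 1: "integrable M (\<lambda>\<omega>. indicator (A i) \<omega> * Z \<omega> (f \<omega> - g \<omega>))"
        using integrable_mult_indicator[OF AM int, of i] by simp
      have 2: "integrable M (\<lambda>\<omega>. indicator (A i) \<omega> * ?d \<omega>)"
        using integrable_mult_indicator[OF AM int_d, of i] by simp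
      \<comment> \<open>Subtracting the integral of \<open>\<phi> i\<close> over the cell changes
        nothing, as it vanishes; what remains involves only \<open>Z \<omega> - \<phi> i\<close>, of
        norm at most \<open>e\<close>.\<close>
      have "(LINT \<omega>:A i|M. Z \<omega> (f \<omega> - g \<omega>))
          = (\<integral>\<omega>. indicator (A i) \<omega> * Z \<omega> (f \<omega> - g \<omega>) - indicator (A i) \<omega> * \<phi> i (f \<omega> - g \<omega>) \<partial>M)"
        using 0 1 by (simp add: set_lebesgue_integral_def has_bochner_integral_iff)
      also have "\<bar>\<dots>\<bar> \<le> (\<integral>\<omega>. e * (indicator (A i) \<omega> * ?d \<omega>) \<partial>M)"
      proof (rule order_trans[OF integral_abs_bound integral_mono])
        fix \<omega> assume "\<omega> \<in> space M"
        show "\<bar>indicator (A i) \<omega> * Z \<omega> (f \<omega> - g \<omega>) - indicator (A i) \<omega> * \<phi> i (f \<omega> - g \<omega>)\<bar>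
            \<le> e * (indicator (A i) \<omega> * ?d \<omega>)"
        proof (cases "\<omega> \<in> A i")
          case True
          then have "norm (Z \<omega> - \<phi> i) \<le> e"
            using \<phi>[of \<omega>] sub unfolding A_def subalgebra_def by (auto simp: dist_norm)
          then have "norm (Z \<omega> - \<phi> i) * ?d \<omega> \<le> e * ?d \<omega>"
            by (intro mult_right_mono) auto
          with norm_blinfun[of "Z \<omega> - \<phi> i" "f \<omega> - g \<omega>"] True show ?thesis
            by (simp add: blinfun.diff_left)
        qed simp
      qed (use 0 1 2 in \<open>auto simp: has_bochner_integral_iff\<close>)
      also have "\<dots> = e * (LINT \<omega>:A i|M. ?d \<omega>)"
        by (simp add: set_lebesgue_integral_def)
      finally show ?thesis .
    qed
    have s1: "(\<lambda>i. LINT \<omega>:A i|M. Z \<omega> (f \<omega> - g \<omega>)) sums (\<integral>\<omega>. Z \<omega> (f \<omega> - g \<omega>) \<partial>M)"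
      by (rule sums[OF int])
    have s2: "(\<lambda>i. e * (LINT \<omega>:A i|M. ?d \<omega>)) sums (e * (\<integral>\<omega>. ?d \<omega> \<partial>M))"
      by (rule sums_mult[OF sums[OF int_d]])
    have "norm (\<Sum>i. LINT \<omega>:A i|M. Z \<omega> (f \<omega> - g \<omega>)) \<le> (\<Sum>i. e * (LINT \<omega>:A i|M. ?d \<omega>))"
      using cell by (intro norm_suminf_le sums_summable[OF s2]) simp
    then show ?thesis
      using sums_unique[OF s1] sums_unique[OF s2] by simp
  qed
  \<comment> \<open>The integral of \<open>?d\<close> is finite and independent of \<open>e\<close>,
    so \<open>e\<close> may tend to 0 from the right.\<close>
  have "((\<lambda>e. e * (\<integral>\<omega>. ?d \<omega> \<partial>M)) \<longlongrightarrow> 0 * (\<integral>\<omega>. ?d \<omega> \<partial>M)) (at_right 0)"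
    by (intro tendsto_intros)
  then have "\<bar>\<integral>\<omega>. Z \<omega> (f \<omega> - g \<omega>) \<partial>M\<bar> \<le> 0 * (\<integral>\<omega>. ?d \<omega> \<partial>M)"
    by (rule tendsto_lowerbound) (auto intro!: eventually_at_rightI[of 0 1] bound)
  then show ?thesis by simp
qed

section \<open>Quadratic remainder bounds for smooth functions\<close>

text \<open>Monotonicity along the segment replaces the integral form of the remainder: subtracting
  the linear term and the quadratic bound at parameter \<open>r\<close> leaves a function with
  nonpositive derivative on the unit interval, and its values at 0 and 1 give the claim.\<close>

lemma descent_upper:
  fixes F :: "'e::real_normed_vector \<Rightarrow> real" and F' :: "'e \<Rightarrow> 'e \<Rightarrow>\<^sub>L real"
  assumes F': "\<And>u. (F has_derivative blinfun_apply (F' u)) (at u)"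
    and L: "\<And>u u'. norm (F' u - F' u') \<le> L * norm (u - u')"
  shows "F (v + h) - F v - F' v h \<le> L / 2 * (norm h)\<^sup>2"
proof -
  define \<phi> where "\<phi> = (\<lambda>r. F (v + r *\<^sub>R h) - r * F' v h - L / 2 * (norm h)\<^sup>2 * r\<^sup>2)"
  have "\<phi> 1 \<le> \<phi> 0"
  proof (rule DERIV_nonpos_imp_nonincreasing[where f = \<phi> and a = 0 and b = 1])
    fix r :: real assume r: "0 \<le> r" "r \<le> 1"
    have "((\<lambda>r. F (v + r *\<^sub>R h)) has_derivative (\<lambda>y. F' (v + r *\<^sub>R h) (y *\<^sub>R h))) (at r)"
      by (rule has_derivative_compose[OF _ F']) (auto intro!: derivative_eq_intros)
    then have "((\<lambda>r. F (v + r *\<^sub>R h)) has_real_derivative F' (v + r *\<^sub>R h) h) (at r)"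
      by (simp add: has_field_derivative_def blinfun.scaleR_right mult_commute_abs)
    then have "(\<phi> has_real_derivative (F' (v + r *\<^sub>R h) h - F' v h - L * (norm h)\<^sup>2 * r)) (at r)"
      unfolding \<phi>_def by (auto intro!: derivative_eq_intros)
    moreover have "F' (v + r *\<^sub>R h) h - F' v h \<le> L * (norm h)\<^sup>2 * r"
    proof -
      have "F' (v + r *\<^sub>R h) h - F' v h \<le> norm (F' (v + r *\<^sub>R h) - F' v) * norm h"
        using norm_blinfun[of "F' (v + r *\<^sub>R h) - F' v" h] by (simp add: blinfun.diff_left)
      also have "\<dots> \<le> L * norm (r *\<^sub>R h) * norm h"
        using L[of "v + r *\<^sub>R h" v] by (intro mult_right_mono) auto
      finally show ?thesis
        using r by (simp add: power2_eq_square mult_ac)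
    qed
    ultimately show "\<exists>y. (\<phi> has_real_derivative y) (at r) \<and> y \<le> 0"
      by (metis diff_le_0_iff_le)
  qed simp
  then show ?thesis
    unfolding \<phi>_def by simp
qed

text \<open>The lower bound is the upper bound for \<open>- F\<close>, whose derivative
  \<open>- F'\<close> satisfies the same Lipschitz estimate.\<close>

lemma descent:
  fixes F :: "'e::real_normed_vector \<Rightarrow> real" and F' :: "'e \<Rightarrow> 'e \<Rightarrow>\<^sub>L real"
  assumes F': "\<And>u. (F has_derivative blinfun_apply (F' u)) (at u)"
    and L: "\<And>u u'. norm (F' u - F' u') \<le> L * norm (u - u')"
  shows "\<bar>F (v + h) - F v - F' v h\<bar> \<le> L / 2 * (norm h)\<^sup>2"
proof -
  have "((\<lambda>u. - F u) has_derivative blinfun_apply (- F' u)) (at u)" for u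
  proof -
    have "blinfun_apply (- F' u) = (\<lambda>h. - F' u h)"
      by (simp add: fun_eq_iff blinfun.minus_left)
    then show ?thesis
      using has_derivative_minus[OF F', of u] by simp
  qed
  moreover have "norm (- F' u - (- F' u')) \<le> L * norm (u - u')" for u u'
    using L[of u u'] by (simp add: norm_minus_commute)
  ultimately have "- F (v + h) - (- F v) - (- F' v) h \<le> L / 2 * (norm h)\<^sup>2"
    by (rule descent_upper)
  with descent_upper[OF F' L, of v h] show ?thesis
    by (auto simp: blinfun.minus_left abs_if)
qed

section \<open>Exchange of the deterministic vectors for the random ones\<close>

theorem lemma2p1:
  fixes M :: "'w measure"
    and F :: "'e::real_normed_vector \<Rightarrow> real"
    and L\<^sub>1 :: real
    and T :: nat
    and x :: "nat \<Rightarrow> 'e"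
    and l :: "nat \<Rightarrow> real"
    and a :: "nat \<Rightarrow> 'w \<Rightarrow> 'e"
  assumes "prob_space M"
    and "L_smooth L\<^sub>1 F"
    and "l \<in> prob_simplex T"
    and "\<And>t. t \<in> {1..T} \<Longrightarrow> random_vector M (a t)"
    and "\<And>t. t \<in> {1..T} \<Longrightarrow> is_cond_exp M (past M a t) (a t) (\<lambda>_. x t)"
  shows "let \<Delta> = (\<lambda>\<omega>. F (\<Sum>t=1..T. l t *\<^sub>R a t \<omega>) - F (\<Sum>t=1..T. l t *\<^sub>R x t));
             R = ennreal (L\<^sub>1 / 2) *
                   (\<Sum>t=1..T. ennreal ((l t)\<^sup>2) * (\<integral>\<^sup>+\<omega>. ennreal ((norm (a t \<omega> - x t))\<^sup>2) \<partial>M))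
         in (R < \<infinity> \<longrightarrow> integrable M \<Delta>) \<and> ennreal \<bar>\<integral>\<omega>. \<Delta> \<omega> \<partial>M\<bar> \<le> R"
proof -
  note a = assms(4) and ce = assms(5)
  \<comment> \<open>The sign of \<open>L\<^sub>1\<close> is not prescribed. Truncation at 0
    preserves the Lipschitz bound, and it leaves \<open>R\<close> unchanged because
    \<open>ennreal\<close> maps negative reals to 0.\<close>
  define K where "K = max L\<^sub>1 0"
  obtain F' :: "'e \<Rightarrow> 'e \<Rightarrow>\<^sub>L real"
    where F': "\<And>u. (F has_derivative blinfun_apply (F' u)) (at u)"
      and L1: "\<And>u u'. norm (F' u - F' u') \<le> L\<^sub>1 * norm (u - u')"
    using assms(2) unfolding L_smooth_def by blast
  have K0: "0 \<le> K" and K1: "ennreal (L\<^sub>1 / 2) = ennreal (K / 2)"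
    unfolding K_def by (auto simp: max_def ennreal_neg)
  have K: "norm (F' u - F' u') \<le> K * norm (u - u')" for u u'
    using L1[of u u'] mult_right_mono[of L\<^sub>1 K "norm (u - u')"] unfolding K_def by simp
  have cont_F': "continuous_on UNIV F'"
    using K K0 lipschitz_on_continuous_on[of K UNIV F'] by (simp add: lipschitz_on_def dist_norm)
  have cont_F: "continuous_on UNIV F"
    using has_derivative_continuous[OF F'] by (simp add: continuous_on_eq_continuous_at)

  define d where "d = (\<lambda>t \<omega>. l t *\<^sub>R (a t \<omega> - x t))"
  \<comment> \<open>The first \<open>t\<close> vectors are random and the rest deterministic, so
    \<open>y 0\<close> and \<open>y T\<close> are the two weighted averages. For positive
    \<open>t\<close> the sum in \<open>y (t - 1)\<close> runs over \<open>{1..<t}\<close>, exactly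
    the indices that generate \<open>past M a t\<close>.\<close>
  define y where "y = (\<lambda>t \<omega>. (\<Sum>s=1..T. l s *\<^sub>R x s) + (\<Sum>s\<in>{1..<Suc t}. d s \<omega>))"
  define q where "q = (\<lambda>t \<omega>. K / 2 * (norm (d t \<omega>))\<^sup>2)"
  define \<Delta> where "\<Delta> = (\<lambda>\<omega>. F (\<Sum>t=1..T. l t *\<^sub>R a t \<omega>) - F (\<Sum>t=1..T. l t *\<^sub>R x t))"
  define R where "R = ennreal (L\<^sub>1 / 2) *
    (\<Sum>t=1..T. ennreal ((l t)\<^sup>2) * (\<integral>\<^sup>+\<omega>. ennreal ((norm (a t \<omega> - x t))\<^sup>2) \<partial>M))"

  have rv_d: "random_vector M (d t)" if "t \<in> {1..T}" for t
    unfolding d_def by (intro random_vector_scaleR random_vector_diff random_vector_const a that)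
  then have [measurable]: "(\<lambda>\<omega>. norm (d t \<omega>)) \<in> borel_measurable M" if "t \<in> {1..T}" for t
    using that borel_measurable_norm_random_vector by blast
  have [measurable]: "(\<lambda>\<omega>. norm (a t \<omega> - x t)) \<in> borel_measurable M" if "t \<in> {1..T}" for t
    using that by (intro borel_measurable_norm_random_vector random_vector_diff random_vector_const a)
  have rv_y: "random_vector M (y t)" if "t \<le> T" for t
    unfolding y_def using that
    by (intro random_vector_add random_vector_sum random_vector_const rv_d) auto
  have rv_y_past: "random_vector (past M a t) (y (t - 1))" if "t \<in> {1..T}" for t
    unfolding y_def d_def using that
    by (intro random_vector_add random_vector_sum random_vector_const random_vector_scaleR
        random_vector_diff random_vector_past a) auto
  \<comment> \<open>First moments come from the conditional expectation, not from \<open>R\<close>,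
    which carries no information on them when \<open>K = 0\<close>.\<close>
  have int_d: "integrable M (\<lambda>\<omega>. norm (d t \<omega>))" if "t \<in> {1..T}" for t
  proof (rule Bochner_Integration.integrable_bound)
    show "integrable M (\<lambda>\<omega>. \<bar>l t\<bar> * (norm (a t \<omega>) + norm (x t)))"
      using is_cond_exp_integrable_norm[OF ce[OF that]] by simp
    show "AE \<omega> in M. norm (norm (d t \<omega>)) \<le> norm (\<bar>l t\<bar> * (norm (a t \<omega>) + norm (x t)))"
      unfolding d_def by (rule AE_I2) (auto intro!: mult_left_mono norm_triangle_ineq4)
  qed (use that in measurable)

  have R_eq: "R = (\<Sum>t=1..T. \<integral>\<^sup>+\<omega>. ennreal (q t \<omega>) \<partial>M)"
    unfolding R_def K1 sum_distrib_left
  proof (rule sum.cong[OF refl])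
    fix t assume "t \<in> {1..T}"
    note [measurable] = this
    show "ennreal (K / 2) * (ennreal ((l t)\<^sup>2) * (\<integral>\<^sup>+\<omega>. ennreal ((norm (a t \<omega> - x t))\<^sup>2) \<partial>M))
        = (\<integral>\<^sup>+\<omega>. ennreal (q t \<omega>) \<partial>M)"
      unfolding q_def d_def norm_scaleR power_mult_distrib power2_abs using K0
      by (simp add: ennreal_mult nn_integral_cmult del: times_divide_eq_left)
  qed

  have fin: "integrable M \<Delta> \<and> ennreal \<bar>\<integral>\<omega>. \<Delta> \<omega> \<partial>M\<bar> \<le> R" if "R < \<infinity>"
  proof -
    have int_q: "integrable M (q t)" if t: "t \<in> {1..T}" for t
    proof (rule integrableI_nonneg)
      show "q t \<in> borel_measurable M" unfolding q_def using t by measurable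
      show "(\<integral>\<^sup>+\<omega>. ennreal (q t \<omega>) \<partial>M) < \<infinity>"
        using member_le_sum[of t "{1..T}" "\<lambda>t. \<integral>\<^sup>+\<omega>. ennreal (q t \<omega>) \<partial>M"] \<open>R < \<infinity>\<close> t
        unfolding R_eq by (meson finite_atLeastAtMost le_less_trans zero_le)
    qed (simp add: q_def K0)
    \<comment> \<open>The increment of \<open>F\<close> at step \<open>t\<close> splits into its
      linear part \<open>f t\<close> and the remainder \<open>r t\<close>.\<close>
    define f where "f = (\<lambda>t \<omega>. F' (y (t - 1) \<omega>) (d t \<omega>))"
    define r where "r = (\<lambda>t \<omega>. F (y t \<omega>) - F (y (t - 1) \<omega>) - f t \<omega>)"
    have int_f: "integrable M (f t)" if t: "t \<in> {1..T}" for t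
    proof (rule Bochner_Integration.integrable_bound)
      \<comment> \<open>The norm of \<open>F'\<close> grows at most linearly in the distance from
        the deterministic average, so \<open>f t\<close> is bounded by a multiple of
        \<open>norm (d t \<omega>)\<close> plus products
        \<open>K * norm (d s \<omega>) * norm (d t \<omega>)\<close>. The inequality
        \<open>2 * u * v \<le> u^2 + v^2\<close> bounds each product by
        \<open>q s \<omega> + q t \<omega>\<close>.\<close>
      let ?B = "\<lambda>\<omega>. norm (F' (\<Sum>s=1..T. l s *\<^sub>R x s)) * norm (d t \<omega>) + (\<Sum>s\<in>{1..<t}. q s \<omega> + q t \<omega>)"
      show "integrable M ?B"
        using t by (intro Bochner_Integration.integrable_add integrable_mult_right
            Bochner_Integration.integrable_sum int_d int_q) auto
      show "f t \<in> borel_measurable M"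
        unfolding f_def using t
        by (intro borel_measurable_blinfun_apply_random_vector rv_d
            random_vector_compose[OF rv_y cont_F']) auto
      show "AE \<omega> in M. norm (f t \<omega>) \<le> norm (?B \<omega>)"
      proof (rule AE_I2)
        fix \<omega>
        let ?x = "\<Sum>s=1..T. l s *\<^sub>R x s"
        have y_x: "y (t - 1) \<omega> - ?x = (\<Sum>s\<in>{1..<t}. d s \<omega>)"
          unfolding y_def using t by simp
        have "norm (F' (y (t - 1) \<omega>)) \<le> norm (F' ?x) + K * norm (y (t - 1) \<omega> - ?x)"
          using norm_triangle_ineq2[of "F' (y (t - 1) \<omega>)" "F' ?x"] K[of "y (t - 1) \<omega>" ?x] by simp
        also have "\<dots> \<le> norm (F' ?x) + K * (\<Sum>s\<in>{1..<t}. norm (d s \<omega>))"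
          unfolding y_x by (intro add_left_mono mult_left_mono norm_sum K0)
        finally have "norm (F' (y (t - 1) \<omega>)) * norm (d t \<omega>)
            \<le> (norm (F' ?x) + K * (\<Sum>s\<in>{1..<t}. norm (d s \<omega>))) * norm (d t \<omega>)"
          by (rule mult_right_mono) simp
        also have "\<dots> = norm (F' ?x) * norm (d t \<omega>)
            + (\<Sum>s\<in>{1..<t}. K / 2 * (2 * norm (d s \<omega>) * norm (d t \<omega>)))"
          by (simp add: distrib_right sum_distrib_left sum_distrib_right mult.assoc)
        also have "\<dots> \<le> ?B \<omega>"
          unfolding q_def distrib_left[symmetric]
          by (intro add_left_mono sum_mono mult_left_mono sum_squares_bound) (simp add: K0)
        finally show "norm (f t \<omega>) \<le> norm (?B \<omega>)"
          unfolding f_def real_norm_def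
          using norm_blinfun[of "F' (y (t - 1) \<omega>)" "d t \<omega>"] by simp
      qed
    qed
    have f0: "(\<integral>\<omega>. f t \<omega> \<partial>M) = 0" if t: "t \<in> {1..T}" for t
    \<comment> \<open>A zero weight makes \<open>d t\<close> vanish. Otherwise dividing by
      \<open>l t\<close> turns integrability of \<open>f t\<close> into integrability of the
      functional applied to \<open>a t \<omega> - x t\<close>, as the orthogonality lemma
      requires.\<close>
    proof (cases "l t = 0")
      case False
      have f_eq: "f t = (\<lambda>\<omega>. l t * F' (y (t - 1) \<omega>) (a t \<omega> - x t))"
        unfolding f_def d_def by (simp add: blinfun.scaleR_right)
      have "(\<integral>\<omega>. F' (y (t - 1) \<omega>) (a t \<omega> - x t) \<partial>M) = 0"
        using int_f[OF t] False unfolding f_eq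
        by (intro is_cond_exp_orthogonal[OF ce[OF t] a[OF t] random_vector_compose[OF rv_y_past[OF t] cont_F']])
          simp
      then show ?thesis unfolding f_eq by simp
    qed (simp add: f_def d_def)
    have r_le: "\<bar>r t \<omega>\<bar> \<le> q t \<omega>" if t: "t \<in> {1..T}" for t \<omega>
    proof -
      have "y t \<omega> = y (t - 1) \<omega> + d t \<omega>"
        unfolding y_def using t by (cases t) auto
      then show ?thesis
        unfolding r_def f_def q_def using descent[OF F' K, of "y (t - 1) \<omega>" "d t \<omega>"] by simp
    qed
    have int_r: "integrable M (r t)" if t: "t \<in> {1..T}" for t
    proof (rule Bochner_Integration.integrable_bound[OF int_q[OF t]])
      have "(\<lambda>\<omega>. F (y s \<omega>)) \<in> borel_measurable M" if "s \<le> T" for s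
        using random_vector_compose[OF rv_y[OF that] cont_F] by (simp add: random_vector_second_countable)
      then show "r t \<in> borel_measurable M"
        unfolding r_def using t borel_measurable_integrable[OF int_f[OF t]]
        by (intro borel_measurable_diff) auto
      show "AE \<omega> in M. norm (r t \<omega>) \<le> norm (q t \<omega>)"
        unfolding real_norm_def using order_trans[OF r_le[OF t] abs_ge_self] by blast
    qed
    have \<Delta>_eq: "\<Delta> = (\<lambda>\<omega>. \<Sum>t=1..T. f t \<omega> + r t \<omega>)"
    proof
      fix \<omega>
      have "y T \<omega> = (\<Sum>t=1..T. l t *\<^sub>R a t \<omega>)" "y 0 \<omega> = (\<Sum>t=1..T. l t *\<^sub>R x t)"
        unfolding y_def d_def
        by (simp_all add: atLeastLessThanSuc_atLeastAtMost scaleR_diff_right sum_subtractf)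
      then have "\<Delta> \<omega> = F (y T \<omega>) - F (y 0 \<omega>)"
        unfolding \<Delta>_def by simp
      \<comment> \<open>Telescoping, with \<open>y\<close> kept as a fixed sequence while the upper
        limit of the sum varies.\<close>
      also have "\<dots> = (\<Sum>t=1..T. F (y t \<omega>) - F (y (t - 1) \<omega>))"
        by (induction T) simp_all
      finally show "\<Delta> \<omega> = (\<Sum>t=1..T. f t \<omega> + r t \<omega>)"
        unfolding r_def by simp
    qed
    have "integrable M \<Delta>"
      unfolding \<Delta>_eq by (intro Bochner_Integration.integrable_sum Bochner_Integration.integrable_add int_f int_r)
    \<comment> \<open>The linear parts have expectation zero, so only the remainders, each bounded
      by \<open>q t\<close>, contribute.\<close>
    moreover have "(\<integral>\<omega>. \<Delta> \<omega> \<partial>M) = (\<Sum>t=1..T. \<integral>\<omega>. r t \<omega> \<partial>M)"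
      unfolding \<Delta>_eq using int_f int_r f0 by simp
    moreover have "\<bar>\<Sum>t=1..T. \<integral>\<omega>. r t \<omega> \<partial>M\<bar> \<le> (\<Sum>t=1..T. \<integral>\<omega>. q t \<omega> \<partial>M)"
      using int_r int_q r_le
      by (intro order_trans[OF sum_abs] sum_mono order_trans[OF integral_abs_bound integral_mono]) auto
    moreover have "ennreal (\<Sum>t=1..T. \<integral>\<omega>. q t \<omega> \<partial>M) = R"
      unfolding R_eq using int_q K0
      by (simp add: nn_integral_eq_integral q_def flip: sum_ennreal)
    ultimately show ?thesis
      by (metis ennreal_leI)
  qed
  have "(R < \<infinity> \<longrightarrow> integrable M \<Delta>) \<and> ennreal \<bar>\<integral>\<omega>. \<Delta> \<omega> \<partial>M\<bar> \<le> R"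
    \<comment> \<open>For infinite \<open>R\<close> both claims are trivial.\<close>
    using fin by (cases "R < \<infinity>") (auto simp: less_top[symmetric])
  then show ?thesis
    unfolding \<Delta>_def R_def Let_def .
qed

end
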